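(* Let $(X,d_X,\leq_{P_1})$ and $(Y,d_Y,\leq_{P_2})$ be two partially ordered complete metric spaces and let $F:X\times Y\rightarrow X$, $G:Y\times X\rightarrow Y$ be two mappings (not assumed continuous) having the mixed monotone property. Assume that $X$ and $Y$ have the following properties: (i) if a non-decreasing sequence $\{x_j\}$ in $X$ converges to $x\in X$, then $x_j\leq_{P_1} x$ for all $j$; (ii) if a non-increasing sequence $\{y_j\}$ in $Y$ converges to $y\in Y$, then $y\leq_{P_2} y_j$ for all $j$. Also assume that there exist $k,l \in \left[0,\frac{1}{2}\right)$ such that $$d_X(F(x,y),F(u,v))\leq k\, M(x,y,u,v)\quad \text{for all } x,u\in X,\ y,v\in Y \text{ with } x\geq_{P_1}u,\ y\leq_{P_2}v,$$ $$d_Y(G(y,x),G(v,u))\leq l\, N(y,x,v,u)\quad \text{for all } x,u\in X,\ y,v\in Y \text{ with } x\leq_{P_1}u,\ y\geq_{P_2}v,$$ where $$M(x,y,u,v)= \max \{d_X(x,u),\,d_X(x,F(x,y)),\,d_X(x,F(u,v)),\,d_X(u,F(u,v)),\,d_X(u,F(x,y))\},$$ $$N(y,x,v,u)= \max \{ d_Y(y,v),\, d_Y(y,G(y,x)),\, d_Y(y,G(v,u)),\, d_Y(v,G(v,u)),\, d_Y(v,G(y,x)) \}.$$ If there exist $x_0\in X$, $y_0\in Y$ satisfying $x_0\leq_{P_1} F(x_0, y_0)$ and $y_0\geq_{P_2} G(y_0, x_0)$, then there exist $x\in X$, $y\in Y$ such that $x=F(x,y)$ and $y=G(y,x)$.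
   Context: A partially ordered complete metric space $(X,d_X,\leq_{P_1})$ is a set $X$ with a metric $d_X$ for which it is complete and a partial order $\leq_{P_1}$ (no compatibility between them is assumed beyond what is stated). The maps $F:X\times Y\to X$ and $G:Y\times X\to Y$ have the mixed monotone property if for all $x\in X$, $y\in Y$: for all $x_1,x_2\in X$, $x_1\leq_{P_1} x_2$ implies $F(x_1,y)\leq_{P_1} F(x_2,y)$ and $G(y,x_1)\geq_{P_2}G(y,x_2)$; and for all $y_1,y_2\in Y$, $y_1\leq_{P_2}y_2$ implies $F(x,y_1)\geq_{P_1}F(x,y_2)$ and $G(y_1,x)\leq_{P_2}G(y_2,x)$. *)

theory Defs
  imports "HOL-Analysis.Analysis"
begin

definition mixed_monotone ::
  "('a::order \<Rightarrow> 'b::order \<Rightarrow> 'a) \<Rightarrow> ('b \<Rightarrow> 'a \<Rightarrow> 'b) \<Rightarrow> bool" where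
  "mixed_monotone F G \<longleftrightarrow>
     (\<forall>x y.
        (\<forall>x1 x2. x1 \<le> x2 \<longrightarrow> F x1 y \<le> F x2 y \<and> G y x1 \<ge> G y x2) \<and>
        (\<forall>y1 y2. y1 \<le> y2 \<longrightarrow> F x y1 \<ge> F x y2 \<and> G y1 x \<le> G y2 x))"

text \<open>
  The expression is symmetric in the roles of the two spaces: for \<open>F : X \<times> Y \<rightarrow> X\<close> the value
  \<open>quasi_max F x y u v\<close> is \<open>M(x,y,u,v)\<close>, and for \<open>G : Y \<times> X \<rightarrow> Y\<close> the value
  \<open>quasi_max G y x v u\<close> is \<open>N(y,x,v,u)\<close>.
\<close>
definition quasi_max ::
  "('a::metric_space \<Rightarrow> 'b \<Rightarrow> 'a) \<Rightarrow> 'a \<Rightarrow> 'b \<Rightarrow> 'a \<Rightarrow> 'b \<Rightarrow> real" where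
  "quasi_max F x y u v =
     Max {dist x u, dist x (F x y), dist x (F u v), dist u (F u v), dist u (F x y)}"

end

theory Submission
  imports Defs
begin

text \<open>
  Alternating \<open>F\<close> and \<open>G\<close> from \<open>(x0, y0)\<close> gives an increasing sequence in \<open>X\<close> and a decreasing
  one in \<open>Y\<close>. By the triangle inequality \<open>M\<close> is at most the sum of two successive
  step lengths, so each step shrinks by the factor \<open>k / (1 - k) < 1\<close> and the sequences are Cauchy.
  The order conditions make each limit comparable with its sequence, so the contraction
  inequality applies to them; its limit is \<open>d(x, F(x, y)) \<le> k d(x, F(x, y))\<close>.
\<close>

lemma Cauchy_if_geometric_steps:
  fixes X :: "nat \<Rightarrow> 'a::metric_space"
  assumes q: "0 \<le> q" "q < 1"
    and step: "\<And>n. dist (X (Suc n)) (X (Suc (Suc n))) \<le> q * dist (X n) (X (Suc n))"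
  shows "Cauchy X"
proof -
  define C where "C = dist (X 0) (X (Suc 0))"
  have bound: "dist (X n) (X (Suc n)) \<le> q ^ n * C" for n
  proof (induction n)
    case (Suc n)
    have "q * dist (X n) (X (Suc n)) \<le> q * (q ^ n * C)"
      using Suc q by (intro mult_left_mono)
    with step[of n] show ?case by (simp add: mult.assoc)
  qed (simp add: C_def)
  \<comment> \<open>Multiplying by \<open>1 - q\<close> turns the partial geometric sum into a
    difference of powers, so the induction step is pure algebra.\<close>
  have tele: "(1 - q) * dist (X m) (X (m + p)) \<le> (q ^ m - q ^ (m + p)) * C" for m p
  proof (induction p)
    case (Suc p)
    have "(1 - q) * dist (X m) (X (m + Suc p))
        \<le> (1 - q) * (dist (X m) (X (m + p)) + q ^ (m + p) * C)"
      using dist_triangle[of "X m" "X (Suc (m + p))" "X (m + p)"] bound[of "m + p"] q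
      by (intro mult_left_mono) auto
    with Suc show ?case by (simp add: algebra_simps)
  qed simp
  have lim: "(\<lambda>m. q ^ m * C / (1 - q)) \<longlonglongrightarrow> 0"
    using q by (auto intro!: tendsto_eq_intros LIMSEQ_realpow_zero)
  have dist_le: "dist (X m) (X n) \<le> q ^ m * C / (1 - q)" if "m \<le> n" for m n
  proof -
    have "(1 - q) * dist (X m) (X n) \<le> (q ^ m - q ^ n) * C"
      using tele[of m "n - m"] that by simp
    also have "\<dots> \<le> q ^ m * C"
      using q by (simp add: C_def left_diff_distrib)
    finally show ?thesis
      using q by (simp add: field_simps)
  qed
  show ?thesis
    unfolding Cauchy_altdef
  proof (intro allI impI)
    fix e :: real
    assume "0 < e"
    then obtain M where "\<And>m. M \<le> m \<Longrightarrow> q ^ m * C / (1 - q) < e"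
      using order_tendstoD(2)[OF lim] by (auto simp: eventually_sequentially)
    then show "\<exists>M. \<forall>m\<ge>M. \<forall>n>m. dist (X m) (X n) < e"
      by (meson dist_le less_imp_le order_le_less_trans)
  qed
qed

lemma quasi_max_commute: "quasi_max F u v x y = quasi_max F x y u v"
proof -
  have "{dist u x, dist u (F u v), dist u (F x y), dist x (F x y), dist x (F u v)} =
        {dist x u, dist x (F x y), dist x (F u v), dist u (F u v), dist u (F x y)}"
    by (auto simp: dist_commute)
  then show ?thesis
    by (simp only: quasi_max_def)
qed

text \<open>Since \<open>F\<close> sends each iterate to the next, one of the five entries vanishes
  and three are single steps. Only \<open>dist (X n) (X (Suc (Suc n)))\<close> spans two
  steps.\<close>

lemma quasi_max_iterates_le:
  assumes "\<And>n. X (Suc n) = F (X n) (Y n)"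
  shows "quasi_max F (X (Suc n)) (Y (Suc n)) (X n) (Y n)
    \<le> dist (X n) (X (Suc n)) + dist (X (Suc n)) (X (Suc (Suc n)))"
  using dist_triangle[of "X n" "X (Suc (Suc n))" "X (Suc n)"]
  by (simp add: quasi_max_def dist_commute flip: assms)

text \<open>The inequality is assumed only between consecutive iterates, which keeps the order out:
  the lemma serves both \<open>F\<close> with increasing \<open>X\<close> and \<open>G\<close> with
  decreasing \<open>Y\<close>.\<close>

lemma quasi_contractive_iterates_Cauchy:
  fixes X :: "nat \<Rightarrow> 'a::metric_space"
  assumes k: "0 \<le> k" "k < 1/2"
    and X: "\<And>n. X (Suc n) = F (X n) (Y n)"
    and contr: "\<And>n. dist (F (X (Suc n)) (Y (Suc n))) (F (X n) (Y n))
      \<le> k * quasi_max F (X (Suc n)) (Y (Suc n)) (X n) (Y n)"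
  shows "Cauchy X"
proof (rule Cauchy_if_geometric_steps)
  show "0 \<le> k / (1 - k)" "k / (1 - k) < 1"
    using k by (auto simp: field_simps)
  fix n
  let ?d = "dist (X n) (X (Suc n))" and ?d' = "dist (X (Suc n)) (X (Suc (Suc n)))"
  have "?d' \<le> k * quasi_max F (X (Suc n)) (Y (Suc n)) (X n) (Y n)"
    using contr[of n] by (simp add: dist_commute flip: X)
  also have "\<dots> \<le> k * (?d + ?d')"
    using k quasi_max_iterates_le[of X F Y, OF X] by (intro mult_left_mono)
  \<comment> \<open>The term \<open>k * ?d'\<close> moves to the left; \<open>k < 1/2\<close> is
    what makes the resulting ratio less than 1.\<close>
  finally show "?d' \<le> k / (1 - k) * ?d"
    using k by (simp add: field_simps)
qed

text \<open>The contraction inequality between the limit and the iterates stands in for continuity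
  of \<open>F\<close>.\<close>

lemma quasi_contractive_limit_fixed:
  fixes X :: "nat \<Rightarrow> 'a::metric_space"
  assumes k: "0 \<le> k" "k < 1"
    and X: "\<And>n. X (Suc n) = F (X n) (Y n)"
    and lim: "X \<longlonglongrightarrow> x"
    and contr: "\<And>n. dist (F x y) (F (X n) (Y n)) \<le> k * quasi_max F x y (X n) (Y n)"
  shows "x = F x y"
proof -
  \<comment> \<open>By the triangle inequality through \<open>x\<close>, \<open>?b n\<close>
    dominates all five entries of the maximum, and it tends to
    \<open>dist x (F x y)\<close>.\<close>
  let ?b = "\<lambda>n. dist x (F x y) + dist (X n) x + dist (X (Suc n)) x"
  have "dist (F x y) (X (Suc n)) \<le> k * ?b n" for n
  proof -
    have "quasi_max F x y (X n) (Y n) \<le> ?b n"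
      using dist_triangle2[of "X n" "X (Suc n)" x] dist_triangle[of "X n" "F x y" x]
      by (simp add: quasi_max_def dist_commute flip: X)
        (use zero_le_dist[of x "F x y"] zero_le_dist[of x "X (Suc n)"] in linarith)
    then show ?thesis
      using contr[of n] k by (metis X mult_left_mono order_trans)
  qed
  moreover have "(\<lambda>n. dist (F x y) (X (Suc n))) \<longlonglongrightarrow> dist (F x y) x"
    using lim by (intro tendsto_intros LIMSEQ_Suc)
  moreover have "(\<lambda>n. k * ?b n) \<longlonglongrightarrow> k * (dist x (F x y) + dist x x + dist x x)"
    using lim by (intro tendsto_intros LIMSEQ_Suc)
  ultimately have "dist (F x y) x \<le> k * (dist x (F x y) + dist x x + dist x x)"
    by (meson LIMSEQ_le)
  then have "(1 - k) * dist x (F x y) \<le> 0"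
    by (simp add: dist_commute algebra_simps)
  with k show ?thesis
    by (simp add: mult_le_0_iff)
qed

theorem theorem3p2:
  fixes F :: "'a::{complete_space, order} \<Rightarrow> 'b::{complete_space, order} \<Rightarrow> 'a"
    and G :: "'b \<Rightarrow> 'a \<Rightarrow> 'b"
  assumes "mixed_monotone F G"
    and "\<And>(X :: nat \<Rightarrow> 'a) x. incseq X \<Longrightarrow> X \<longlonglongrightarrow> x \<Longrightarrow> \<forall>j. X j \<le> x"
    and "\<And>(Y :: nat \<Rightarrow> 'b) y. decseq Y \<Longrightarrow> Y \<longlonglongrightarrow> y \<Longrightarrow> \<forall>j. y \<le> Y j"
    and "\<exists>k l :: real. k \<in> {0..<1/2} \<and> l \<in> {0..<1/2} \<and>
           (\<forall>x u y v. x \<ge> u \<longrightarrow> y \<le> v \<longrightarrow>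
              dist (F x y) (F u v) \<le> k * quasi_max F x y u v) \<and>
           (\<forall>x u y v. x \<le> u \<longrightarrow> y \<ge> v \<longrightarrow>
              dist (G y x) (G v u) \<le> l * quasi_max G y x v u)"
    and "\<exists>x0 y0. x0 \<le> F x0 y0 \<and> y0 \<ge> G y0 x0"
  shows "\<exists>x y. x = F x y \<and> y = G y x"
proof -
  obtain k l :: real
    where k: "0 \<le> k" "k < 1/2" and l: "0 \<le> l" "l < 1/2"
      and contrF: "\<And>x u y v. u \<le> x \<Longrightarrow> y \<le> v \<Longrightarrow>
        dist (F x y) (F u v) \<le> k * quasi_max F x y u v"
      and "\<And>x u y v. x \<le> u \<Longrightarrow> v \<le> y \<Longrightarrow>
        dist (G y x) (G v u) \<le> l * quasi_max G y x v u"
    using assms(4) by auto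
  \<comment> \<open>The two pairs are swapped so that the one with the smaller \<open>Y\<close>
    component comes first: it will be the later iterate or the limit, as the lemmas above
    expect.\<close>
  then have contrG: "dist (G v u) (G y x) \<le> l * quasi_max G v u y x"
    if "x \<le> u" "v \<le> y" for x u y v
    using that by (metis dist_commute quasi_max_commute)
  obtain x0 y0 where start: "x0 \<le> F x0 y0" "G y0 x0 \<le> y0"
    using assms(5) by auto
  \<comment> \<open>The joint map on pairs is monotone for the product order with the order of the
    second factor reversed.\<close>
  have mono: "F x y \<le> F x' y'" "G y' x' \<le> G y x" if "x \<le> x'" "y' \<le> y" for x x' y y'
    using assms(1) that unfolding mixed_monotone_def by (meson order_trans)+

  \<comment> \<open>The two recursions are coupled, so the pair is iterated and then
    projected.\<close>
  define S where "S n = ((\<lambda>(x, y). (F x y, G y x)) ^^ n) (x0, y0)" for n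
  define X where "X n = fst (S n)" for n
  define Y where "Y n = snd (S n)" for n
  have X: "X (Suc n) = F (X n) (Y n)" and Y: "Y (Suc n) = G (Y n) (X n)" for n
    by (simp_all add: X_def Y_def S_def case_prod_beta)
  have step: "X n \<le> X (Suc n) \<and> Y (Suc n) \<le> Y n" for n
  proof (induction n)
    case 0
    from start show ?case by (simp add: X_def Y_def S_def)
  next
    case (Suc n)
    then show ?case using mono by (metis X Y)
  qed
  then have inc: "incseq X" and dec: "decseq Y"
    by (simp_all add: incseq_Suc_iff decseq_Suc_iff)

  have "Cauchy X" "Cauchy Y"
    using quasi_contractive_iterates_Cauchy[of k X F Y, OF k X contrF]
      quasi_contractive_iterates_Cauchy[of l Y G X, OF l Y contrG] step by auto
  then obtain x y where lim: "X \<longlonglongrightarrow> x" "Y \<longlonglongrightarrow> y"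
    by (auto simp: Cauchy_convergent_iff convergent_def)
  then have bounds: "X n \<le> x" "y \<le> Y n" for n
    using assms(2)[OF inc] assms(3)[OF dec] by auto
  \<comment> \<open>By \<open>bounds\<close>, the limit pair lies on the same side of every iterate
    as the next iterate does, so \<open>contrF\<close> and \<open>contrG\<close> apply to
    it.\<close>
  have "x = F x y"
    using k lim bounds by (intro quasi_contractive_limit_fixed[of k X F Y] X contrF) auto
  moreover have "y = G y x"
    using l lim bounds by (intro quasi_contractive_limit_fixed[of l Y G X] Y contrG) auto
  ultimately show ?thesis by blast
qed

end
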